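(* Suppose that $\mathbb{Q}$ admits a strictly positive density $f(x,y,\theta)\varphi(\theta)$ over $F\times G\times\Theta$ with respect to the $\sigma$-finite measure $\lambda\otimes\mu\otimes\nu$, with $f$ and $\varphi$ continuous with respect to $\theta$ on $\Theta$. Suppose that $$\mathbb{E}_\theta(Y\mid X)=A(X)+B(\theta)C(X)+D(\theta),\qquad\theta\in\Theta,$$ where $A$, $B\otimes C$ and $D$ (regarded as functions $A(x)$, $B(\theta)C(x)$, $D(\theta)$ of $(x,\theta)$) belong to $L^2(\mathbb{Q}_{(X,\mathbb{T})})$. Then the associated Bayesian predictor is $$p_0(X)=A(X)+\mathbb{E}(B(\mathbb{T})\mid X)\cdot C(X)+\mathbb{E}(D(\mathbb{T})\mid X).$$ In particular, if $X$ and $Y$ are independent (under each $\mathbb{P}_\theta$) and $D(\theta)=\mathbb{E}_\theta(Y)$, the predictor reduces to the estimator $p_0(X)=\mathbb{E}(D(\mathbb{T})\mid X)$.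
   Context: $(X,Y)$ is a random vector with values in $(F\times G,\mathcal{F}\otimes\mathcal{G})$, where $F$, $G$ are $\mathbb{N}$ or $\mathbb{R}^k$, and $Y$ is real valued and square integrable. Its distribution belongs to a family $(\mathbb{P}_\theta,\theta\in\Theta)$, where $\Theta\subset\mathbb{R}$ is open and $\mathbb{P}_\theta$ has density $f(x,y,\theta)$ with respect to $\lambda\otimes\mu$. A random variable $\mathbb{T}$ with values in $\Theta$ has prior density $\varphi$ with respect to a $\sigma$-finite measure $\nu$. $\mathbb{Q}$ is the joint law of $(X,Y,\mathbb{T})$, with density $f(x,y,\theta)\varphi(\theta)$ with respect to $\lambda\otimes\mu\otimes\nu$, and $\mathbb{Q}_{(X,\mathbb{T})}$ is the law of $(X,\mathbb{T})$. $\mathbb{E}_\theta$ refers to $\mathbb{P}_\theta$ and $\mathbb{E}$ to $\mathbb{Q}$. The version of $\mathbb{E}_\theta(Y\mid X)$ used is $$m(X,\theta)=\frac{\int_G y f(X,y,\theta)\,d\mu(y)}{\int_G f(X,y,\theta)\,d\mu(y)},$$ so that $m(X,\mathbb{T})=\mathbb{E}(Y\mid X,\mathbb{T})$. The Bayesian predictor is $p_0(X)=\arg\min_p\mathbb{E}(p(X)-Y)^2=\mathbb{E}(Y\mid X)$, the minimum being over real measurable functions of $X$. Equalities are almost sure. Conditional expectations given $X$ of functions of $\mathbb{T}$ are integrals against the posterior density of $\mathbb{T}$ given $X$, and the product $\mathbb{E}(B(\mathbb{T})\mid X)\cdot C(X)$ is read as $0$ where $C(X)=0$. *)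

theory Defs
  imports "HOL-Probability.Probability"
begin

text \<open>The model lives on canonical spaces: \<open>(x, y)\<close> under \<open>law_theta\<close> and \<open>(x, y, t)\<close> under
  \<open>law_joint\<close>; \<open>X\<close>, \<open>Y\<close> and the random parameter are the coordinate maps.\<close>

definition law_theta ::
  "'x measure \<Rightarrow> real measure \<Rightarrow> ('x \<Rightarrow> real \<Rightarrow> real \<Rightarrow> real) \<Rightarrow> real \<Rightarrow> ('x \<times> real) measure" where
  "law_theta lam \<mu> f \<theta> = density (lam \<Otimes>\<^sub>M \<mu>) (\<lambda>(x, y). ennreal (f x y \<theta>))"

definition law_joint ::
  "'x measure \<Rightarrow> real measure \<Rightarrow> real measure \<Rightarrow> ('x \<Rightarrow> real \<Rightarrow> real \<Rightarrow> real) \<Rightarrow> (real \<Rightarrow> real)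
    \<Rightarrow> ('x \<times> real \<times> real) measure" where
  "law_joint lam \<mu> \<nu> f \<phi> =
     density (lam \<Otimes>\<^sub>M \<mu> \<Otimes>\<^sub>M \<nu>) (\<lambda>(x, y, \<theta>). ennreal (f x y \<theta> * \<phi> \<theta>))"

definition law_X_theta ::
  "'x measure \<Rightarrow> real measure \<Rightarrow> real measure \<Rightarrow> ('x \<Rightarrow> real \<Rightarrow> real \<Rightarrow> real) \<Rightarrow> (real \<Rightarrow> real)
    \<Rightarrow> ('x \<times> real) measure" where
  "law_X_theta lam \<mu> \<nu> f \<phi> =
     distr (law_joint lam \<mu> \<nu> f \<phi>) (lam \<Otimes>\<^sub>M \<nu>) (\<lambda>(x, y, \<theta>). (x, \<theta>))"

definition square_integrable :: "'a measure \<Rightarrow> ('a \<Rightarrow> real) \<Rightarrow> bool" where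
  "square_integrable M g \<longleftrightarrow> g \<in> borel_measurable M \<and> integrable M (\<lambda>w. (g w)\<^sup>2)"

text \<open>The fixed version \<open>m(x, \<theta>)\<close> of the conditional expectation of \<open>Y\<close> given \<open>X = x\<close> under
  parameter \<open>\<theta>\<close>.\<close>

definition cond_mean :: "real measure \<Rightarrow> ('x \<Rightarrow> real \<Rightarrow> real \<Rightarrow> real) \<Rightarrow> 'x \<Rightarrow> real \<Rightarrow> real" where
  "cond_mean \<mu> f x \<theta> = (\<integral>y. y * f x y \<theta> \<partial>\<mu>) / (\<integral>y. f x y \<theta> \<partial>\<mu>)"

definition posterior_density ::
  "real measure \<Rightarrow> real measure \<Rightarrow> ('x \<Rightarrow> real \<Rightarrow> real \<Rightarrow> real) \<Rightarrow> (real \<Rightarrow> real)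
    \<Rightarrow> 'x \<Rightarrow> real \<Rightarrow> real" where
  "posterior_density \<mu> \<nu> f \<phi> x \<theta> =
     (\<integral>y. f x y \<theta> * \<phi> \<theta> \<partial>\<mu>) / (\<integral>t. (\<integral>y. f x y t * \<phi> t \<partial>\<mu>) \<partial>\<nu>)"

text \<open>The conditional expectation of \<open>g\<close> of the random parameter given \<open>X = x\<close>, as a posterior
  integral. Where the posterior integral does not exist, the value is \<open>0\<close>; a product with a
  factor \<open>C x = 0\<close> is then \<open>0\<close>.\<close>

definition posterior_mean ::
  "real measure \<Rightarrow> real measure \<Rightarrow> ('x \<Rightarrow> real \<Rightarrow> real \<Rightarrow> real) \<Rightarrow> (real \<Rightarrow> real)
    \<Rightarrow> (real \<Rightarrow> real) \<Rightarrow> 'x \<Rightarrow> real" where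
  "posterior_mean \<mu> \<nu> f \<phi> g x = (\<integral>\<theta>. g \<theta> * posterior_density \<mu> \<nu> f \<phi> x \<theta> \<partial>\<nu>)"

text \<open>Minimisers of the quadratic risk; the risk is a nonnegative integral, so that competitors
  of infinite risk are admitted.\<close>

definition bayes_predictor ::
  "'x measure \<Rightarrow> ('x \<times> real \<times> real) measure \<Rightarrow> ('x \<Rightarrow> real) \<Rightarrow> bool" where
  "bayes_predictor lam Q p \<longleftrightarrow>
     p \<in> borel_measurable lam \<and>
     (\<forall>q \<in> borel_measurable lam.
        (\<integral>\<^sup>+(x, y, \<theta>). ennreal ((p x - y)\<^sup>2) \<partial>Q) \<le> (\<integral>\<^sup>+(x, y, \<theta>). ennreal ((q x - y)\<^sup>2) \<partial>Q))"

text \<open>\<open>r\<close> is the Bayesian predictor: it attains the minimal risk, every minimiser agrees with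
  it almost surely, and it is a version of the conditional expectation of \<open>Y\<close> given \<open>X\<close>.\<close>

definition is_the_bayes_predictor ::
  "'x measure \<Rightarrow> ('x \<times> real \<times> real) measure \<Rightarrow> ('x \<Rightarrow> real) \<Rightarrow> bool" where
  "is_the_bayes_predictor lam Q r \<longleftrightarrow>
     bayes_predictor lam Q r \<and>
     (\<forall>p. bayes_predictor lam Q p \<longrightarrow> (AE (x, y, \<theta>) in Q. p x = r x)) \<and>
     (AE w in Q. real_cond_exp Q (vimage_algebra (space Q) fst lam) (\<lambda>(x, y, \<theta>). y) w = r (fst w))"

end

theory Submission
  imports Defs
begin

text \<open>
  The Bayesian predictor is the orthogonal projection of \<open>Y\<close> onto the square integrable functions
  of \<open>X\<close>. Hence any measurable \<open>r\<close> for which \<open>r(X)\<close> is a version of \<open>E(Y | X)\<close> attains the minimal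
  quadratic risk, and every other minimiser coincides with it almost surely: the excess risk of
  \<open>q\<close> is \<open>E((q(X) - r(X))\<^sup>2)\<close> (\<open>mean_square_risk_decomposition\<close>, \<open>is_the_bayes_predictorI\<close>). It
  remains to compute \<open>E(Y | X)\<close>.

  In a law with a density on a product of two \<open>\<sigma>\<close>-finite spaces, the conditional expectation given
  the first coordinate is the integral over the second coordinate divided by the marginal
  density (\<open>real_cond_exp_density_pair\<close>). Splitting the triple as \<open>x\<close> and \<open>(y, \<theta>)\<close>, this gives
  \<open>E(Y | X = x)\<close> as a quotient of two integrals over \<open>(y, \<theta>)\<close>. Integrating first over \<open>y\<close>
  rewrites the quotient as the integral of \<open>m(x, \<theta>)\<close> against the posterior density of the
  parameter (\<open>integral_cond_mean_post\<close>): the tower property \<open>E(Y | X) = E(m(X, T) | X)\<close>, in terms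
  of densities.

  An assumption on \<open>m(x, \<theta>)\<close> that holds for each \<open>\<theta>\<close> and almost every \<open>x\<close> also holds, by Fubini,
  for almost every \<open>x\<close> and almost every \<open>\<theta>\<close>, so it may be inserted into the posterior integral
  (\<open>is_the_bayes_predictor_regression\<close>). For \<open>m(x, \<theta>) = A(x) + B(\<theta>) C(x) + D(\<theta>)\<close> the integral
  splits by linearity, because square integrability makes each of the three summands integrable
  against almost every posterior density. If \<open>X\<close> and \<open>Y\<close> are independent, then
  \<open>m(X, \<theta>)\<close> is the mean of \<open>Y\<close> almost surely, and the same argument applies to \<open>m(x, \<theta>) = D(\<theta>)\<close>.
\<close>

section \<open>Conditional expectations and the quadratic risk\<close>

lemma integrable_mult_of_squares:
  fixes U V :: "'a \<Rightarrow> real"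
  assumes [measurable]: "U \<in> borel_measurable M" "V \<in> borel_measurable M"
    and "integrable M (\<lambda>w. (U w)\<^sup>2)" "integrable M (\<lambda>w. (V w)\<^sup>2)"
  shows "integrable M (\<lambda>w. U w * V w)"
proof (rule Bochner_Integration.integrable_bound)
  show "integrable M (\<lambda>w. (U w)\<^sup>2 + (V w)\<^sup>2)"
    using assms by simp
  have "\<bar>a * b\<bar> \<le> a\<^sup>2 + b\<^sup>2" for a b :: real
    using sum_squares_bound[of "\<bar>a\<bar>" "\<bar>b\<bar>"] mult_nonneg_nonneg[of "\<bar>a\<bar>" "\<bar>b\<bar>"]
    unfolding abs_mult power2_abs by linarith
  then show "AE w in M. norm (U w * V w) \<le> norm ((U w)\<^sup>2 + (V w)\<^sup>2)"
    by (intro always_eventually allI) (metis abs_of_nonneg add_nonneg_nonneg real_norm_def zero_le_power2)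
qed simp

lemma integrable_power2_diff:
  fixes U V :: "'a \<Rightarrow> real"
  assumes [measurable]: "U \<in> borel_measurable M" "V \<in> borel_measurable M"
    and "integrable M (\<lambda>w. (U w)\<^sup>2)" "integrable M (\<lambda>w. (V w)\<^sup>2)"
  shows "integrable M (\<lambda>w. (U w - V w)\<^sup>2)"
proof -
  have "integrable M (\<lambda>w. (U w)\<^sup>2 + (V w)\<^sup>2 - 2 * (U w * V w))"
    using assms integrable_mult_of_squares[OF assms] by simp
  then show ?thesis
    by (simp add: power2_diff mult.assoc)
qed

text \<open>Competitors \<open>U\<close> outside \<open>L\<^sup>2\<close> have infinite risk, since \<open>U = (U - V) + V\<close>.\<close>

lemma nn_integral_power2_infinite:
  fixes U V :: "'a \<Rightarrow> real"
  assumes [measurable]: "U \<in> borel_measurable M" "V \<in> borel_measurable M"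
    and U: "\<not> integrable M (\<lambda>w. (U w)\<^sup>2)" and V: "integrable M (\<lambda>w. (V w)\<^sup>2)"
  shows "(\<integral>\<^sup>+w. ennreal ((U w - V w)\<^sup>2) \<partial>M) = \<infinity>"
proof (rule ccontr)
  assume "\<not> ?thesis"
  then have "integrable M (\<lambda>w. (U w - V w)\<^sup>2)"
    by (intro integrableI_nonneg) (auto simp: less_top)
  moreover have "integrable M (\<lambda>w. (- V w)\<^sup>2)"
    using V by simp
  ultimately have "integrable M (\<lambda>w. (U w - V w - - V w)\<^sup>2)"
    by (rule integrable_power2_diff[rotated 2]) auto
  then show False
    using U by simp
qed

lemma (in prob_space) sigma_finite_subalgebra_generated:
  assumes "X \<in> measurable M L"
  shows "sigma_finite_subalgebra M (vimage_algebra (space M) X L)"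
proof -
  have "subalgebra M (vimage_algebra (space M) X L)"
    using sets_image_in_sets[OF refl assms] by (simp add: subalgebra_def)
  then show ?thesis
    by (intro finite_measure_subalgebra_is_sigma_finite finite_measure_subalgebra.intro
        finite_measure_subalgebra_axioms.intro finite_measure_axioms)
qed

text \<open>Pythagoras: \<open>q(X) - r(X)\<close> is orthogonal to \<open>r(X) - Y\<close>, because \<open>r(X)\<close> is the conditional
  expectation of \<open>Y\<close>; and \<open>r(X)\<close> is in \<open>L\<^sup>2\<close> by Jensen's inequality. In nonnegative integrals the
  identity covers \<open>q(X)\<close> outside \<open>L\<^sup>2\<close> as well, both sides then being infinite.\<close>

lemma (in prob_space) mean_square_risk_decomposition:
  fixes Y :: "'a \<Rightarrow> real" and q r :: "'b \<Rightarrow> real"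
  assumes X [measurable]: "X \<in> measurable M L"
    and Y [measurable]: "Y \<in> borel_measurable M" and Y2: "integrable M (\<lambda>w. (Y w)\<^sup>2)"
    and r [measurable]: "r \<in> borel_measurable L" and q [measurable]: "q \<in> borel_measurable L"
    and ce: "AE w in M. real_cond_exp M (vimage_algebra (space M) X L) Y w = r (X w)"
  shows "integrable M (\<lambda>w. (r (X w))\<^sup>2)"
    and "(\<integral>\<^sup>+w. ennreal ((q (X w) - Y w)\<^sup>2) \<partial>M) =
         (\<integral>\<^sup>+w. ennreal ((q (X w) - r (X w))\<^sup>2) \<partial>M) + (\<integral>\<^sup>+w. ennreal ((r (X w) - Y w)\<^sup>2) \<partial>M)"
      (is "?Q = ?D + ?R")
proof -
  let ?F = "vimage_algebra (space M) X L"
  interpret sigma_finite_subalgebra M ?F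
    using X by (rule sigma_finite_subalgebra_generated)
  have XF [measurable]: "X \<in> measurable ?F L"
    by (rule measurable_vimage_algebra1) (use measurable_space[OF X] in auto)
  have Y1: "integrable M Y"
    using Y Y2 by (rule square_integrable_imp_integrable)
  have "integrable M (\<lambda>w. (real_cond_exp M ?F Y w)\<^sup>2)"
    by (rule integrable_convex_cond_exp[where I = UNIV, OF Y1 _ _ Y2])
      (auto simp: convex_power2)
  then show r2: "integrable M (\<lambda>w. (r (X w))\<^sup>2)"
    by (rule integrable_cong_AE_imp) (use ce in auto)
  have rY: "integrable M (\<lambda>w. (r (X w) - Y w)\<^sup>2)"
    by (intro integrable_power2_diff r2 Y2) auto
  show "?Q = ?D + ?R"
  proof (cases "integrable M (\<lambda>w. (q (X w))\<^sup>2)")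
    case True
    have qr: "integrable M (\<lambda>w. (q (X w) - r (X w))\<^sup>2)"
      by (intro integrable_power2_diff r2 True) auto
    have qY: "integrable M (\<lambda>w. (q (X w) - r (X w)) * Y w)"
      by (intro integrable_mult_of_squares qr Y2) auto
    have qR: "integrable M (\<lambda>w. (q (X w) - r (X w)) * r (X w))"
      by (intro integrable_mult_of_squares qr r2) auto
    have "(\<integral>w. (q (X w) - r (X w)) * r (X w) \<partial>M)
        = (\<integral>w. (q (X w) - r (X w)) * real_cond_exp M ?F Y w \<partial>M)"
      by (rule integral_cong_AE) (use ce in auto)
    also have "\<dots> = (\<integral>w. (q (X w) - r (X w)) * Y w \<partial>M)"
      by (rule real_cond_exp_intg(2)[OF qY]) auto
    finally have orth: "(\<integral>w. (q (X w) - r (X w)) * r (X w) \<partial>M) = (\<integral>w. (q (X w) - r (X w)) * Y w \<partial>M)" .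
    have "(q (X w) - Y w)\<^sup>2 = (q (X w) - r (X w))\<^sup>2 + (r (X w) - Y w)\<^sup>2
        + 2 * ((q (X w) - r (X w)) * r (X w) - (q (X w) - r (X w)) * Y w)" for w
      by (simp add: power2_eq_square algebra_simps)
    then have "(\<integral>w. (q (X w) - Y w)\<^sup>2 \<partial>M)
        = (\<integral>w. (q (X w) - r (X w))\<^sup>2 \<partial>M) + (\<integral>w. (r (X w) - Y w)\<^sup>2 \<partial>M)"
      using qr rY qY qR orth by simp
    then show ?thesis
      using qr rY integrable_power2_diff[OF _ Y True Y2]
      by (simp add: nn_integral_eq_integral ennreal_plus)
  next
    case False
    then have "?D = \<infinity>" "?Q = \<infinity>"
      using r2 Y2 by (intro nn_integral_power2_infinite; simp)+
    then show ?thesis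
      by simp
  qed
qed

text \<open>The risk of \<open>r\<close> is finite, so it can be cancelled in the decomposition above: a minimiser
  \<open>p\<close> has \<open>E((p(X) - r(X))\<^sup>2) = 0\<close>.\<close>

lemma is_the_bayes_predictorI:
  fixes Q :: "('x \<times> real \<times> real) measure" and r :: "'x \<Rightarrow> real"
  assumes "prob_space Q" and X [measurable]: "fst \<in> measurable Q lam"
    and Y2: "square_integrable Q (\<lambda>(x, y, \<theta>). y)"
    and r [measurable]: "r \<in> borel_measurable lam"
    and ce: "AE w in Q. real_cond_exp Q (vimage_algebra (space Q) fst lam) (\<lambda>(x, y, \<theta>). y) w = r (fst w)"
  shows "is_the_bayes_predictor lam Q r"
proof -
  interpret prob_space Q by fact
  let ?Y = "\<lambda>(x, y, \<theta>). y"
  have Y [measurable]: "?Y \<in> borel_measurable Q" and Y2: "integrable Q (\<lambda>w. (?Y w)\<^sup>2)"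
    using Y2 by (auto simp: square_integrable_def)
  define risk where "risk q = (\<integral>\<^sup>+(x, y, \<theta>). ennreal ((q x - y)\<^sup>2) \<partial>Q)" for q :: "'x \<Rightarrow> real"
  have risk: "risk q = (\<integral>\<^sup>+w. ennreal ((q (fst w) - r (fst w))\<^sup>2) \<partial>Q) + risk r"
    if "q \<in> borel_measurable lam" for q
    using mean_square_risk_decomposition(2)[OF X Y Y2 r that ce]
    unfolding risk_def by (simp only: split_def)
  have r2: "integrable Q (\<lambda>w. (r (fst w))\<^sup>2)"
    by (rule mean_square_risk_decomposition(1)[OF X Y Y2 r r ce])
  have "risk r = ennreal (\<integral>w. (r (fst w) - ?Y w)\<^sup>2 \<partial>Q)"
    using nn_integral_eq_integral[OF integrable_power2_diff[OF _ Y r2 Y2]]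
    by (simp add: risk_def split_def)
  then have fin: "risk r \<noteq> \<infinity>"
    by simp
  have min: "bayes_predictor lam Q r"
    unfolding bayes_predictor_def risk_def[symmetric]
  proof (intro conjI ballI)
    fix q :: "'x \<Rightarrow> real" assume "q \<in> borel_measurable lam"
    then show "risk r \<le> risk q"
      by (subst risk) simp_all
  qed fact
  have "AE (x, y, \<theta>) in Q. p x = r x" if p: "bayes_predictor lam Q p" for p
  proof -
    have [measurable]: "p \<in> borel_measurable lam" and "risk p \<le> risk r"
      using p r by (auto simp: bayes_predictor_def risk_def)
    then have "risk r + (\<integral>\<^sup>+w. ennreal ((p (fst w) - r (fst w))\<^sup>2) \<partial>Q) \<le> risk r + 0"
      by (subst add.commute, subst risk[symmetric]) simp_all
    then have "(\<integral>\<^sup>+w. ennreal ((p (fst w) - r (fst w))\<^sup>2) \<partial>Q) = 0"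
      using fin unfolding ennreal_add_left_cancel_le by simp
    then have "AE w in Q. ennreal ((p (fst w) - r (fst w))\<^sup>2) = 0"
      by (subst (asm) nn_integral_0_iff_AE) auto
    then show ?thesis
      by eventually_elim (auto simp: ennreal_eq_0_iff)
  qed
  then show ?thesis
    using min ce by (simp add: is_the_bayes_predictor_def)
qed

section \<open>Conditional expectations for densities and under independence\<close>

text \<open>With \<open>N\<close> the numerator and \<open>Z\<close> the denominator of the quotient, integrating out the second
  coordinate turns both required integrals over \<open>{X \<in> S}\<close> into the integral of \<open>N\<close> over \<open>S\<close>.
  Where \<open>Z x = 0\<close> the quotient is \<open>0\<close> by convention, but there \<open>h (x, _)\<close> vanishes almost
  everywhere and so \<open>N x = 0\<close> too.\<close>

lemma real_cond_exp_density_pair: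
  fixes h V :: "'a \<times> 'b \<Rightarrow> real"
  assumes "sigma_finite_measure M1" "sigma_finite_measure M2"
    and h [measurable]: "h \<in> borel_measurable (M1 \<Otimes>\<^sub>M M2)"
    and h_nonneg: "\<And>w. w \<in> space (M1 \<Otimes>\<^sub>M M2) \<Longrightarrow> 0 \<le> h w"
    and R: "R = density (M1 \<Otimes>\<^sub>M M2) (\<lambda>w. ennreal (h w))" "prob_space R"
    and V: "integrable R V"
  shows "AE w in R. real_cond_exp R (vimage_algebra (space R) fst M1) V w
           = (\<integral>z. V (fst w, z) * h (fst w, z) \<partial>M2) / (\<integral>z. h (fst w, z) \<partial>M2)"
proof -
  interpret M1: sigma_finite_measure M1 by fact
  interpret M2: sigma_finite_measure M2 by fact
  interpret pair_sigma_finite M1 M2 ..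
  interpret R: prob_space R by fact
  have sets_R [measurable_cong]: "sets R = sets (M1 \<Otimes>\<^sub>M M2)"
    by (simp add: R)
  have space_R: "space R = space (M1 \<Otimes>\<^sub>M M2)"
    by (simp add: R)
  have V_meas [measurable]: "V \<in> borel_measurable (M1 \<Otimes>\<^sub>M M2)"
    using borel_measurable_integrable[OF V] by simp
  have fst_R: "fst \<in> measurable R M1"
    by simp
  interpret F: sigma_finite_subalgebra R "vimage_algebra (space R) fst M1"
    using fst_R by (rule R.sigma_finite_subalgebra_generated)
  have h_AE: "AE w in M1 \<Otimes>\<^sub>M M2. 0 \<le> h w"
    using h_nonneg by (rule AE_I2)
  have "(\<integral>\<^sup>+w. ennreal (h w) \<partial>(M1 \<Otimes>\<^sub>M M2)) = 1"
    using R.emeasure_space_1 unfolding space_R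
    by (simp add: R(1) emeasure_density cong: nn_integral_cong)
  then have int_h: "integrable (M1 \<Otimes>\<^sub>M M2) h"
    using h_AE by (intro integrableI_nonneg) auto
  have int_R: "integrable R u \<longleftrightarrow> integrable (M1 \<Otimes>\<^sub>M M2) (\<lambda>w. u w * h w)"
    "integral\<^sup>L R u = (\<integral>w. u w * h w \<partial>(M1 \<Otimes>\<^sub>M M2))"
    if "u \<in> borel_measurable (M1 \<Otimes>\<^sub>M M2)" for u :: "'a \<times> 'b \<Rightarrow> real"
    unfolding R(1) using that h h_AE by (simp_all add: integrable_density integral_density mult.commute)
  have int_Vh: "integrable (M1 \<Otimes>\<^sub>M M2) (\<lambda>w. V w * h w)"
    using V int_R(1)[OF V_meas] by simp
  define N where "N x = (\<integral>z. V (x, z) * h (x, z) \<partial>M2)" for x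
  define Z where "Z x = (\<integral>z. h (x, z) \<partial>M2)" for x
  define \<rho> where "\<rho> x = N x / Z x" for x
  have [measurable]: "N \<in> borel_measurable M1" "Z \<in> borel_measurable M1"
    unfolding N_def Z_def by measurable
  then have [measurable]: "\<rho> \<in> borel_measurable M1"
    unfolding \<rho>_def by measurable
  have int_N: "integrable M1 N"
    using integrable_fst'[OF int_Vh] by (simp add: N_def[abs_def])
  have int_hx: "AE x in M1. integrable M2 (\<lambda>z. h (x, z))"
    by (rule AE_integrable_fst'[OF int_h])
  have \<rho>Z: "AE x in M1. 0 \<le> Z x \<and> \<rho> x * Z x = N x"
    using int_hx AE_space
  proof eventually_elim
    case (elim x)
    have nonneg: "AE z in M2. 0 \<le> h (x, z)"
      using elim h_nonneg by (auto intro!: AE_I2 simp: space_pair_measure)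
    have "N x = 0" if "Z x = 0"
    proof -
      have "AE z in M2. h (x, z) = 0"
        using that elim nonneg by (simp add: Z_def integral_nonneg_eq_0_iff_AE)
      then show ?thesis
        unfolding N_def by (intro integral_eq_zero_AE) auto
    qed
    then show ?case
      using nonneg by (auto simp: \<rho>_def Z_def integral_nonneg_AE)
  qed
  \<comment> \<open>the absolute value of this function has integral \<open>\<bar>N x\<bar>\<close> over the second coordinate\<close>
  have int_\<rho>h: "integrable (M1 \<Otimes>\<^sub>M M2) (\<lambda>w. \<rho> (fst w) * h w)"
  proof (rule Fubini_integrable)
    have "AE x in M1. \<bar>N x\<bar> = (\<integral>z. norm (\<rho> (fst (x, z)) * h (x, z)) \<partial>M2)"
      using \<rho>Z AE_space
    proof eventually_elim
      case (elim x)
      have "(\<integral>z. norm (\<rho> (fst (x, z)) * h (x, z)) \<partial>M2) = (\<integral>z. \<bar>\<rho> x\<bar> * h (x, z) \<partial>M2)"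
        using elim h_nonneg by (intro Bochner_Integration.integral_cong) (auto simp: abs_mult space_pair_measure)
      also have "\<dots> = \<bar>\<rho> x\<bar> * Z x"
        by (simp add: Z_def)
      also have "\<dots> = \<bar>N x\<bar>"
        using elim by (metis abs_mult abs_of_nonneg)
      finally show ?case ..
    qed
    then show "integrable M1 (\<lambda>x. \<integral>z. norm (\<rho> (fst (x, z)) * h (x, z)) \<partial>M2)"
      by (intro integrable_cong_AE_imp[OF integrable_abs[OF int_N]]) auto
    show "AE x in M1. integrable M2 (\<lambda>z. \<rho> (fst (x, z)) * h (x, z))"
      using int_hx by eventually_elim simp
  qed simp
  have slice: "(\<integral>w. indicator S (fst w) * u w \<partial>(M1 \<Otimes>\<^sub>M M2)) = (\<integral>x. indicator S x * (\<integral>z. u (x, z) \<partial>M2) \<partial>M1)"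
    if [measurable]: "S \<in> sets M1" and u: "integrable (M1 \<Otimes>\<^sub>M M2) u" for S and u :: "'a \<times> 'b \<Rightarrow> real"
  proof -
    have [measurable]: "u \<in> borel_measurable (M1 \<Otimes>\<^sub>M M2)"
      using u by simp
    have "integrable (M1 \<Otimes>\<^sub>M M2) (\<lambda>w. indicator S (fst w) * u w)"
      using u by (rule Bochner_Integration.integrable_bound) (auto simp: indicator_def)
    from integral_fst'[OF this] show ?thesis
      by simp
  qed
  have "AE w in R. real_cond_exp R (vimage_algebra (space R) fst M1) V w = \<rho> (fst w)"
  proof (rule F.real_cond_exp_charact)
    fix A assume "A \<in> sets (vimage_algebra (space R) fst M1)"
    then obtain S where S [measurable]: "S \<in> sets M1" and A: "A = fst -` S \<inter> space R"
      by (subst (asm) sets_vimage_algebra2) (auto simp: space_R space_pair_measure)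
    have ind: "indicator A w = (indicator S (fst w) :: real)" if "w \<in> space (M1 \<Otimes>\<^sub>M M2)" for w
      using that by (auto simp: A space_R indicator_def)
    have A_int: "(\<integral>w\<in>A. u w \<partial>R) = (\<integral>x. indicator S x * (\<integral>z. u (x, z) * h (x, z) \<partial>M2) \<partial>M1)"
      if [measurable]: "u \<in> borel_measurable (M1 \<Otimes>\<^sub>M M2)"
        and u: "integrable (M1 \<Otimes>\<^sub>M M2) (\<lambda>w. u w * h w)" for u :: "'a \<times> 'b \<Rightarrow> real"
    proof -
      have "(\<integral>w\<in>A. u w \<partial>R) = (\<integral>w. indicator S (fst w) * u w \<partial>R)"
        unfolding set_lebesgue_integral_def
        by (rule Bochner_Integration.integral_cong) (auto simp: ind space_R)
      also have "\<dots> = (\<integral>w. indicator S (fst w) * (u w * h w) \<partial>(M1 \<Otimes>\<^sub>M M2))"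
        by (subst int_R(2)) (auto simp: mult.assoc)
      finally show ?thesis
        using slice[OF S u] by simp
    qed
    have "(\<integral>x. indicator S x * (\<integral>z. \<rho> (fst (x, z)) * h (x, z) \<partial>M2) \<partial>M1)
        = (\<integral>x. indicator S x * N x \<partial>M1)"
      using \<rho>Z by (intro integral_cong_AE) (auto simp: Z_def)
    then show "(\<integral>w\<in>A. V w \<partial>R) = (\<integral>w\<in>A. \<rho> (fst w) \<partial>R)"
      using A_int[OF V_meas int_Vh] A_int[OF _ int_\<rho>h] by (simp add: N_def)
  next
    show "integrable R (\<lambda>w. \<rho> (fst w))"
      using int_R(1) int_\<rho>h by simp
    show "(\<lambda>w. \<rho> (fst w)) \<in> borel_measurable (vimage_algebra (space R) fst M1)"
      by (rule measurable_compose[OF measurable_vimage_algebra1])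
        (use measurable_space[OF fst_R] in auto)
  qed (rule V)
  then show ?thesis
    by (simp add: \<rho>_def N_def Z_def)
qed

text \<open>For \<open>A\<close> in \<open>F\<close> the indicator of \<open>A\<close> and \<open>V\<close> are independent random variables, so
  \<open>E(1\<^sub>A V) = P(A) E(V)\<close>, which is the defining property of the constant \<open>E(V)\<close>.\<close>

lemma (in prob_space) real_cond_exp_indep_set:
  fixes V :: "'a \<Rightarrow> real"
  assumes F: "sigma_finite_subalgebra M F" and H: "space H = space M"
    and indep: "indep_set (sets F) (sets H)"
    and V: "integrable M V" "V \<in> borel_measurable H"
  shows "AE w in M. real_cond_exp M F V w = expectation V"
proof -
  interpret F: sigma_finite_subalgebra M F
    by (rule F)
  have space_F: "space F = space M"
    using F.subalg by (simp add: subalgebra_def)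
  show ?thesis
  proof (rule F.real_cond_exp_charact)
    fix A assume A [measurable]: "A \<in> sets F"
    then have A_M: "A \<in> sets M"
      using F.subalg by (auto simp: subalgebra_def)
    have "(indicator A :: _ \<Rightarrow> real) \<in> borel_measurable F"
      by measurable
    from sets_image_in_sets[OF space_F this] sets_image_in_sets[OF H V(2)]
    have "indep_set (sets (vimage_algebra (space M) (indicator A :: _ \<Rightarrow> real) borel))
        (sets (vimage_algebra (space M) V borel))"
      using indep unfolding indep_set_def by (elim indep_sets_mono) (auto split: bool.split)
    then have "indep_var borel (indicator A) borel V"
      using A_M V by (simp add: indep_var_eq sets_vimage_algebra)
    then have "(\<integral>w. indicator A w * V w \<partial>M) = expectation (indicator A) * expectation V"
      using A_M V by (intro indep_var_lebesgue_integral)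
        (auto intro!: integrable_real_indicator simp: less_top[symmetric])
    then show "(\<integral>w\<in>A. V w \<partial>M) = (\<integral>w\<in>A. expectation V \<partial>M)"
      using A_M by (simp add: set_lebesgue_integral_def)
  qed (use V in simp_all)
qed

section \<open>The Bayesian model\<close>

locale bayes_model =
  lam: sigma_finite_measure lam + mu: sigma_finite_measure \<mu> + nu: sigma_finite_measure \<nu>
  for lam :: "'x measure" and \<mu> \<nu> :: "real measure" +
  fixes f :: "'x \<Rightarrow> real \<Rightarrow> real \<Rightarrow> real" and \<phi> :: "real \<Rightarrow> real"
  assumes f_meas: "(\<lambda>(x, y, \<theta>). f x y \<theta>) \<in> borel_measurable (lam \<Otimes>\<^sub>M \<mu> \<Otimes>\<^sub>M \<nu>)"
    and prior_meas [measurable]: "\<phi> \<in> borel_measurable \<nu>"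
    and obs_meas [measurable]: "(\<lambda>y. y) \<in> borel_measurable \<mu>"
    and f_pos: "\<And>x y \<theta>. x \<in> space lam \<Longrightarrow> y \<in> space \<mu> \<Longrightarrow> \<theta> \<in> space \<nu> \<Longrightarrow> 0 < f x y \<theta>"
    and prior_pos: "\<And>\<theta>. \<theta> \<in> space \<nu> \<Longrightarrow> 0 < \<phi> \<theta>"
    and prob_law: "\<And>\<theta>. \<theta> \<in> space \<nu> \<Longrightarrow> prob_space (law_theta lam \<mu> f \<theta>)"
    and prob_prior: "prob_space (density \<nu> (\<lambda>\<theta>. ennreal (\<phi> \<theta>)))"
    and obs_L2: "square_integrable (law_joint lam \<mu> \<nu> f \<phi>) (\<lambda>(x, y, \<theta>). y)"
begin

sublocale mu_nu: pair_sigma_finite \<mu> \<nu> ..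
sublocale lam_mu: pair_sigma_finite lam \<mu> ..
sublocale lam_nu: pair_sigma_finite lam \<nu> ..
sublocale lam_mu_nu: pair_sigma_finite lam "\<mu> \<Otimes>\<^sub>M \<nu>" ..

abbreviation Q where "Q \<equiv> law_joint lam \<mu> \<nu> f \<phi>"
abbreviation P where "P \<equiv> law_theta lam \<mu> f"
abbreviation post where "post \<equiv> posterior_density \<mu> \<nu> f \<phi>"

definition joint_dens :: "'x \<times> real \<times> real \<Rightarrow> real" where
  "joint_dens = (\<lambda>(x, y, \<theta>). f x y \<theta> * \<phi> \<theta>)"

text \<open>\<open>f\<close> is a curried function of three arguments; in this form the measurability prover can use
  its joint measurability.\<close>

lemma f_comp [measurable (raw)]:
  assumes "g1 \<in> measurable M lam" "g2 \<in> measurable M \<mu>" "g3 \<in> measurable M \<nu>"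
  shows "(\<lambda>w. f (g1 w) (g2 w) (g3 w)) \<in> borel_measurable M"
proof -
  have "(\<lambda>w. (g1 w, g2 w, g3 w)) \<in> measurable M (lam \<Otimes>\<^sub>M \<mu> \<Otimes>\<^sub>M \<nu>)"
    using assms by measurable
  from measurable_compose[OF this f_meas] show ?thesis
    by simp
qed

lemma joint_dens_meas [measurable]: "joint_dens \<in> borel_measurable (lam \<Otimes>\<^sub>M \<mu> \<Otimes>\<^sub>M \<nu>)"
  unfolding joint_dens_def by measurable

lemma joint_dens_pos: "w \<in> space (lam \<Otimes>\<^sub>M \<mu> \<Otimes>\<^sub>M \<nu>) \<Longrightarrow> 0 < joint_dens w"
  using f_pos prior_pos by (auto simp: joint_dens_def space_pair_measure)

lemma Q_density: "Q = density (lam \<Otimes>\<^sub>M \<mu> \<Otimes>\<^sub>M \<nu>) (\<lambda>w. ennreal (joint_dens w))"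
  unfolding law_joint_def joint_dens_def by (simp add: split_def)

lemma P_density: "P \<theta> = density (lam \<Otimes>\<^sub>M \<mu>) (\<lambda>w. ennreal (f (fst w) (snd w) \<theta>))"
  unfolding law_theta_def by (simp add: split_def)

lemma nn_integral_f: "(\<integral>\<^sup>+x. \<integral>\<^sup>+y. ennreal (f x y \<theta>) \<partial>\<mu> \<partial>lam) = 1" if "\<theta> \<in> space \<nu>"
proof -
  have [measurable]: "(\<lambda>_. \<theta>) \<in> measurable M \<nu>" for M :: "'c measure"
    using that by simp
  interpret prob_space "P \<theta>"
    using that by (rule prob_law)
  have [measurable]: "(\<lambda>w. ennreal (f (fst w) (snd w) \<theta>)) \<in> borel_measurable (lam \<Otimes>\<^sub>M \<mu>)"
    by measurable
  have "1 = emeasure (P \<theta>) (space (P \<theta>))"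
    by (rule emeasure_space_1[symmetric])
  also have "\<dots> = (\<integral>\<^sup>+w. ennreal (f (fst w) (snd w) \<theta>) \<partial>(lam \<Otimes>\<^sub>M \<mu>))"
    by (simp add: P_density emeasure_density cong: nn_integral_cong)
  also have "\<dots> = (\<integral>\<^sup>+x. \<integral>\<^sup>+y. ennreal (f x y \<theta>) \<partial>\<mu> \<partial>lam)"
    by (subst mu.nn_integral_fst[symmetric]) simp_all
  finally show ?thesis ..
qed

lemma nn_integral_prior: "(\<integral>\<^sup>+\<theta>. ennreal (\<phi> \<theta>) \<partial>\<nu>) = 1"
  using prob_space.emeasure_space_1[OF prob_prior] by (simp add: emeasure_density cong: nn_integral_cong)

text \<open>The dominating measures \<open>\<nu>\<close> and \<open>\<mu>\<close> are not null, since they carry probability densities; so an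
  almost everywhere statement that does not mention the point is true. This is what makes the
  denominators below positive and lets \<open>y\<close> be dropped from statements on \<open>(x, y)\<close>.\<close>

lemma AE_prior_trivial: "AE \<theta> in \<nu>. R \<Longrightarrow> R"
proof (rule ccontr)
  assume "AE \<theta> in \<nu>. R" "\<not> R"
  then have "AE \<theta> in \<nu>. ennreal (\<phi> \<theta>) = 0"
    by (auto elim: eventually_mono)
  then have "(\<integral>\<^sup>+\<theta>. ennreal (\<phi> \<theta>) \<partial>\<nu>) = (\<integral>\<^sup>+\<theta>. 0 \<partial>\<nu>)"
    by (rule nn_integral_cong_AE)
  then show False
    using nn_integral_prior by simp
qed

lemma space_nu_nonempty: "space \<nu> \<noteq> {}"
  using AE_prior_trivial[of False] by (auto intro: AE_I2)

lemma AE_mu_trivial: "AE y in \<mu>. R \<Longrightarrow> R"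
proof (rule ccontr)
  assume "AE y in \<mu>. R" "\<not> R"
  then have "(\<integral>\<^sup>+y. g y \<partial>\<mu>) = (\<integral>\<^sup>+y. 0 \<partial>\<mu>)" for g :: "real \<Rightarrow> ennreal"
    by (intro nn_integral_cong_AE) (auto elim: eventually_mono)
  moreover obtain \<theta> where "\<theta> \<in> space \<nu>"
    using space_nu_nonempty by auto
  ultimately show False
    using nn_integral_f[of \<theta>] by simp
qed

lemma space_lam_nonempty: "space lam \<noteq> {}"
proof
  assume "space lam = {}"
  moreover obtain \<theta> where "\<theta> \<in> space \<nu>"
    using space_nu_nonempty by auto
  ultimately show False
    using nn_integral_f[of \<theta>] by (simp add: nn_integral_empty)
qed

text \<open>By Tonelli: integrate \<open>f\<close> over \<open>(x, y)\<close> first, then the prior density over \<open>\<theta>\<close>.\<close>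

lemma prob_Q: "prob_space Q"
proof
  have "emeasure Q (space Q) = (\<integral>\<^sup>+w. ennreal (joint_dens w) \<partial>(lam \<Otimes>\<^sub>M \<mu> \<Otimes>\<^sub>M \<nu>))"
    by (simp add: Q_density emeasure_density cong: nn_integral_cong)
  also have "\<dots> = (\<integral>\<^sup>+x. \<integral>\<^sup>+z. ennreal (joint_dens (x, z)) \<partial>(\<mu> \<Otimes>\<^sub>M \<nu>) \<partial>lam)"
    by (rule mu_nu.nn_integral_fst[symmetric]) simp
  also have "\<dots> = (\<integral>\<^sup>+x. \<integral>\<^sup>+\<theta>. \<integral>\<^sup>+y. ennreal (joint_dens (x, y, \<theta>)) \<partial>\<mu> \<partial>\<nu> \<partial>lam)"
    by (intro nn_integral_cong mu_nu.nn_integral_snd[symmetric]) simp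
  also have "\<dots> = (\<integral>\<^sup>+\<theta>. \<integral>\<^sup>+x. \<integral>\<^sup>+y. ennreal (joint_dens (x, y, \<theta>)) \<partial>\<mu> \<partial>lam \<partial>\<nu>)"
    by (rule lam_nu.Fubini'[symmetric]) simp
  also have "\<dots> = (\<integral>\<^sup>+\<theta>. \<integral>\<^sup>+x. \<integral>\<^sup>+y. ennreal (\<phi> \<theta>) * ennreal (f x y \<theta>) \<partial>\<mu> \<partial>lam \<partial>\<nu>)"
    using f_pos prior_pos
    by (intro nn_integral_cong) (simp add: joint_dens_def ennreal_mult' less_imp_le mult.commute)
  also have "\<dots> = (\<integral>\<^sup>+\<theta>. ennreal (\<phi> \<theta>) * (\<integral>\<^sup>+x. \<integral>\<^sup>+y. ennreal (f x y \<theta>) \<partial>\<mu> \<partial>lam) \<partial>\<nu>)"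
  proof (intro nn_integral_cong)
    fix \<theta> assume [measurable]: "\<theta> \<in> space \<nu>"
    have "(\<integral>\<^sup>+x. \<integral>\<^sup>+y. ennreal (\<phi> \<theta>) * ennreal (f x y \<theta>) \<partial>\<mu> \<partial>lam)
        = (\<integral>\<^sup>+x. ennreal (\<phi> \<theta>) * (\<integral>\<^sup>+y. ennreal (f x y \<theta>) \<partial>\<mu>) \<partial>lam)"
      by (intro nn_integral_cong nn_integral_cmult) measurable
    also have "\<dots> = ennreal (\<phi> \<theta>) * (\<integral>\<^sup>+x. \<integral>\<^sup>+y. ennreal (f x y \<theta>) \<partial>\<mu> \<partial>lam)"
      by (rule nn_integral_cmult) measurable
    finally show "(\<integral>\<^sup>+x. \<integral>\<^sup>+y. ennreal (\<phi> \<theta>) * ennreal (f x y \<theta>) \<partial>\<mu> \<partial>lam)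
        = ennreal (\<phi> \<theta>) * (\<integral>\<^sup>+x. \<integral>\<^sup>+y. ennreal (f x y \<theta>) \<partial>\<mu> \<partial>lam)" .
  qed
  also have "\<dots> = 1"
    by (simp add: nn_integral_f nn_integral_prior cong: nn_integral_cong)
  finally show "emeasure Q (space Q) = 1" .
qed

sublocale Q: prob_space Q
  by (rule prob_Q)

lemma sets_Q [measurable_cong]: "sets Q = sets (lam \<Otimes>\<^sub>M \<mu> \<Otimes>\<^sub>M \<nu>)"
  by (simp add: Q_density)

lemma integrable_Q_iff:
  fixes u :: "'x \<times> real \<times> real \<Rightarrow> real"
  assumes [measurable]: "u \<in> borel_measurable (lam \<Otimes>\<^sub>M \<mu> \<Otimes>\<^sub>M \<nu>)"
  shows "integrable Q u \<longleftrightarrow> integrable (lam \<Otimes>\<^sub>M \<mu> \<Otimes>\<^sub>M \<nu>) (\<lambda>w. u w * joint_dens w)"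
  unfolding Q_density using joint_dens_pos
  by (subst integrable_density) (auto simp: mult.commute less_imp_le)

text \<open>Integrability under the joint law passes to almost every \<open>x\<close>; this is how the \<open>L\<^sup>2\<close>
  assumptions reach the posterior integrals.\<close>

lemma AE_integrable_slice:
  fixes u :: "'x \<times> real \<times> real \<Rightarrow> real"
  assumes "integrable Q u"
  shows "AE x in lam. integrable (\<mu> \<Otimes>\<^sub>M \<nu>) (\<lambda>z. u (x, z) * joint_dens (x, z))"
proof -
  have "u \<in> borel_measurable (lam \<Otimes>\<^sub>M \<mu> \<Otimes>\<^sub>M \<nu>)"
    using borel_measurable_integrable[OF assms] by simp
  from integrable_Q_iff[OF this] assms
  have "integrable (lam \<Otimes>\<^sub>M \<mu> \<Otimes>\<^sub>M \<nu>) (\<lambda>w. u w * joint_dens w)"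
    by simp
  from lam_mu_nu.AE_integrable_fst'[OF this] show ?thesis
    by simp
qed

lemma integrable_obs: "integrable Q (\<lambda>(x, y, \<theta>). y)"
  using obs_L2 by (auto simp: square_integrable_def intro: Q.square_integrable_imp_integrable)

subsection \<open>Posterior integrals\<close>

text \<open>The points \<open>x\<close> at which Fubini's theorem applies to \<open>joint_dens\<close> and to \<open>y * joint_dens\<close>
  over \<open>(y, \<theta>)\<close>. At such points none of the quotients involved takes its default value: the
  marginal density of \<open>X\<close> (the evidence) is finite and positive, and so is the density of \<open>X\<close> under almost every
  \<open>\<theta>\<close>.\<close>

definition regular :: "'x \<Rightarrow> bool" where
  "regular x \<longleftrightarrow> x \<in> space lam \<and> integrable (\<mu> \<Otimes>\<^sub>M \<nu>) (\<lambda>z. joint_dens (x, z)) \<and>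
     integrable (\<mu> \<Otimes>\<^sub>M \<nu>) (\<lambda>z. fst z * joint_dens (x, z))"

lemma AE_regular: "AE x in lam. regular x"
proof -
  have "integrable Q (\<lambda>_. 1 :: real)"
    by simp
  from AE_integrable_slice[OF this] AE_integrable_slice[OF integrable_obs] AE_space
  show ?thesis
    by eventually_elim (simp add: regular_def split_def)
qed

lemma evidence_eq:
  assumes "regular x"
  shows "(\<integral>\<theta>. (\<integral>y. f x y \<theta> * \<phi> \<theta> \<partial>\<mu>) \<partial>\<nu>) = (\<integral>z. joint_dens (x, z) \<partial>(\<mu> \<Otimes>\<^sub>M \<nu>))"
  using mu_nu.integral_snd[of "\<lambda>y \<theta>. f x y \<theta> * \<phi> \<theta>"] assms
  by (simp add: regular_def joint_dens_def split_def)

lemma evidence_pos: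
  assumes "regular x"
  shows "0 < (\<integral>z. joint_dens (x, z) \<partial>(\<mu> \<Otimes>\<^sub>M \<nu>))"
proof -
  have x: "x \<in> space lam" and int: "integrable (\<mu> \<Otimes>\<^sub>M \<nu>) (\<lambda>z. joint_dens (x, z))"
    using assms by (auto simp: regular_def)
  have pos: "0 < joint_dens (x, z)" if "z \<in> space (\<mu> \<Otimes>\<^sub>M \<nu>)" for z
    using that x by (intro joint_dens_pos) (auto simp: space_pair_measure)
  have nonneg: "AE z in \<mu> \<Otimes>\<^sub>M \<nu>. 0 \<le> joint_dens (x, z)"
    using pos by (intro AE_I2) (simp add: less_imp_le)
  have "(\<integral>z. joint_dens (x, z) \<partial>(\<mu> \<Otimes>\<^sub>M \<nu>)) \<noteq> 0"
  proof
    assume "(\<integral>z. joint_dens (x, z) \<partial>(\<mu> \<Otimes>\<^sub>M \<nu>)) = 0"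
    then have "AE z in \<mu> \<Otimes>\<^sub>M \<nu>. joint_dens (x, z) = 0"
      using int nonneg by (simp add: integral_nonneg_eq_0_iff_AE)
    then have "AE z in \<mu> \<Otimes>\<^sub>M \<nu>. False"
      using AE_space by eventually_elim (use pos in force)
    then have "AE y in \<mu>. AE \<theta> in \<nu>. False"
      using mu_nu.AE_pair[of "\<lambda>_. False"] by simp
    then show False
      using AE_prior_trivial AE_mu_trivial by metis
  qed
  then show ?thesis
    using integral_nonneg_AE[OF nonneg] by simp
qed

lemma AE_parameter_integrable:
  assumes "regular x"
  shows "AE \<theta> in \<nu>. integrable \<mu> (\<lambda>y. f x y \<theta>) \<and> 0 < (\<integral>y. f x y \<theta> \<partial>\<mu>)"
proof -
  have x: "x \<in> space lam" and int: "integrable (\<mu> \<Otimes>\<^sub>M \<nu>) (\<lambda>(y, \<theta>). f x y \<theta> * \<phi> \<theta>)"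
    using assms by (auto simp: regular_def joint_dens_def split_def)
  have "AE \<theta> in \<nu>. integrable \<mu> (\<lambda>y. f x y \<theta> * \<phi> \<theta>)"
    using int by (rule mu_nu.AE_integrable_snd)
  then show ?thesis
    using AE_space
  proof eventually_elim
    case (elim \<theta>)
    have int_f: "integrable \<mu> (\<lambda>y. f x y \<theta>)"
      using elim prior_pos[of \<theta>] by (simp add: integrable_mult_left_iff)
    have nonneg: "AE y in \<mu>. 0 \<le> f x y \<theta>"
      using f_pos x elim by (intro AE_I2) (simp add: less_imp_le)
    have "(\<integral>y. f x y \<theta> \<partial>\<mu>) \<noteq> 0"
    proof
      assume "(\<integral>y. f x y \<theta> \<partial>\<mu>) = 0"
      then have "AE y in \<mu>. f x y \<theta> = 0"
        using int_f nonneg by (simp add: integral_nonneg_eq_0_iff_AE)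
      then have "AE y in \<mu>. False"
        using AE_space by eventually_elim (use f_pos x elim in force)
      then show False
        by (rule AE_mu_trivial)
    qed
    then show ?case
      using int_f integral_nonneg_AE[OF nonneg] by simp
  qed
qed

lemma cond_mean_meas [measurable]:
  "(\<lambda>(x, \<theta>). cond_mean \<mu> f x \<theta>) \<in> borel_measurable (lam \<Otimes>\<^sub>M \<nu>)"
  unfolding cond_mean_def by measurable

lemma post_meas [measurable]: "(\<lambda>(x, \<theta>). post x \<theta>) \<in> borel_measurable (lam \<Otimes>\<^sub>M \<nu>)"
  unfolding posterior_density_def by measurable

lemma integrable_post:
  assumes "regular x"
    and "integrable (\<mu> \<Otimes>\<^sub>M \<nu>) (\<lambda>z. g (snd z) * joint_dens (x, z))"
  shows "integrable \<nu> (\<lambda>\<theta>. g \<theta> * post x \<theta>)"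
proof -
  have "integrable (\<mu> \<Otimes>\<^sub>M \<nu>) (\<lambda>(y, \<theta>). g \<theta> * (f x y \<theta> * \<phi> \<theta>))"
    using assms(2) by (simp add: joint_dens_def split_def)
  from mu_nu.integrable_snd[OF this]
  have "integrable \<nu> (\<lambda>\<theta>. g \<theta> * (\<integral>y. f x y \<theta> * \<phi> \<theta> \<partial>\<mu>))"
    by (simp only: integral_mult_right_zero)
  then show ?thesis
    unfolding posterior_density_def times_divide_eq_right by (rule integrable_divide)
qed

lemma integral_post:
  assumes "regular x"
  shows "(\<integral>\<theta>. post x \<theta> \<partial>\<nu>) = 1"
  using evidence_pos[OF assms]
  unfolding posterior_density_def integral_divide_zero evidence_eq[OF assms] by simp

text \<open>The marginal density \<open>\<integral> f x y \<theta> \<partial>\<mu>\<close> is both the denominator of \<open>m(x, \<theta>)\<close> and a factor of the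
  numerator of the posterior density. It cancels for almost every \<open>\<theta>\<close>, leaving
  \<open>\<integral> y * f x y \<theta> * \<phi> \<theta> \<partial>\<mu>\<close> divided by the evidence.\<close>

lemma integral_cond_mean_post:
  assumes "regular x"
  shows "(\<integral>\<theta>. cond_mean \<mu> f x \<theta> * post x \<theta> \<partial>\<nu>)
    = (\<integral>z. fst z * joint_dens (x, z) \<partial>(\<mu> \<Otimes>\<^sub>M \<nu>)) / (\<integral>z. joint_dens (x, z) \<partial>(\<mu> \<Otimes>\<^sub>M \<nu>))"
proof -
  let ?Z = "\<integral>z. joint_dens (x, z) \<partial>(\<mu> \<Otimes>\<^sub>M \<nu>)"
  have x [measurable]: "x \<in> space lam"
    and int: "integrable (\<mu> \<Otimes>\<^sub>M \<nu>) (\<lambda>(y, \<theta>). y * (f x y \<theta> * \<phi> \<theta>))"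
    using assms by (auto simp: regular_def joint_dens_def split_def)
  have "(\<integral>\<theta>. cond_mean \<mu> f x \<theta> * post x \<theta> \<partial>\<nu>) = (\<integral>\<theta>. (\<integral>y. y * (f x y \<theta> * \<phi> \<theta>) \<partial>\<mu>) / ?Z \<partial>\<nu>)"
  proof (rule integral_cong_AE)
    show "AE \<theta> in \<nu>. cond_mean \<mu> f x \<theta> * post x \<theta> = (\<integral>y. y * (f x y \<theta> * \<phi> \<theta>) \<partial>\<mu>) / ?Z"
      using AE_parameter_integrable[OF assms]
    proof eventually_elim
      case (elim \<theta>)
      have "(\<integral>y. y * (f x y \<theta> * \<phi> \<theta>) \<partial>\<mu>) = (\<integral>y. y * f x y \<theta> \<partial>\<mu>) * \<phi> \<theta>"
        by (simp flip: mult.assoc)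
      moreover have "post x \<theta> = (\<integral>y. f x y \<theta> \<partial>\<mu>) * \<phi> \<theta> / ?Z"
        unfolding posterior_density_def evidence_eq[OF assms] by simp
      ultimately show ?case
        using elim by (simp add: cond_mean_def)
    qed
  qed measurable
  also have "\<dots> = (\<integral>\<theta>. (\<integral>y. y * (f x y \<theta> * \<phi> \<theta>) \<partial>\<mu>) \<partial>\<nu>) / ?Z"
    by simp
  also have "(\<integral>\<theta>. (\<integral>y. y * (f x y \<theta> * \<phi> \<theta>) \<partial>\<mu>) \<partial>\<nu>) = (\<integral>z. fst z * joint_dens (x, z) \<partial>(\<mu> \<Otimes>\<^sub>M \<nu>))"
    using mu_nu.integral_snd[OF int] by (simp add: joint_dens_def split_def)
  finally show ?thesis .
qed

subsection \<open>From the regression function to the predictor\<close>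

text \<open>Strict positivity of \<open>f\<close> makes each law of the model equivalent to the dominating measure.\<close>

lemma AE_law_theta_fst:
  assumes \<theta>: "\<theta> \<in> space \<nu>" and "AE (x, y) in P \<theta>. R x"
  shows "AE x in lam. R x"
proof -
  have [measurable]: "(\<lambda>_. \<theta>) \<in> measurable M \<nu>" for M :: "'c measure"
    using \<theta> by simp
  have "AE w in lam \<Otimes>\<^sub>M \<mu>. 0 < ennreal (f (fst w) (snd w) \<theta>) \<longrightarrow> R (fst w)"
    using assms(2) unfolding P_density by (subst (asm) AE_density) (simp_all add: split_def)
  then have "AE w in lam \<Otimes>\<^sub>M \<mu>. R (fst w)"
    using AE_space by eventually_elim (use f_pos \<theta> in \<open>auto simp: space_pair_measure\<close>)
  from lam_mu.AE_pair[OF this] show ?thesis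
    by eventually_elim (auto intro: AE_mu_trivial)
qed

text \<open>The identity for \<open>m(x, \<theta>)\<close> has an exceptional null set of \<open>x\<close> for each \<open>\<theta>\<close>. As both sides
  are jointly measurable, the order of the two quantifiers can be exchanged, and \<open>h\<close> replaces \<open>m\<close>
  inside the posterior integral at almost every \<open>x\<close>.\<close>

lemma is_the_bayes_predictor_regression:
  assumes h [measurable]: "(\<lambda>(x, \<theta>). h x \<theta>) \<in> borel_measurable (lam \<Otimes>\<^sub>M \<nu>)"
    and reg: "\<And>\<theta>. \<theta> \<in> space \<nu> \<Longrightarrow> AE (x, y) in P \<theta>. cond_mean \<mu> f x \<theta> = h x \<theta>"
    and r [measurable]: "r \<in> borel_measurable lam"
    and r_eq: "AE x in lam. r x = (\<integral>\<theta>. h x \<theta> * post x \<theta> \<partial>\<nu>)"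
  shows "is_the_bayes_predictor lam Q r"
proof (rule is_the_bayes_predictorI[OF prob_Q _ obs_L2 r])
  have "AE \<theta> in \<nu>. AE x in lam. cond_mean \<mu> f x \<theta> = h x \<theta>"
    by (rule AE_I2) (rule AE_law_theta_fst[OF _ reg])
  then have swap: "AE x in lam. AE \<theta> in \<nu>. cond_mean \<mu> f x \<theta> = h x \<theta>"
    by (subst lam_nu.AE_commute) simp_all
  define \<rho> where "\<rho> x = (\<integral>z. fst z * joint_dens (x, z) \<partial>(\<mu> \<Otimes>\<^sub>M \<nu>)) / (\<integral>z. joint_dens (x, z) \<partial>(\<mu> \<Otimes>\<^sub>M \<nu>))" for x
  have [measurable]: "\<rho> \<in> borel_measurable lam"
    unfolding \<rho>_def by measurable
  have "AE x in lam. r x = \<rho> x"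
    using swap r_eq AE_regular AE_space
  proof eventually_elim
    case (elim x)
    note [measurable] = elim(4)
    have "(\<integral>\<theta>. h x \<theta> * post x \<theta> \<partial>\<nu>) = (\<integral>\<theta>. cond_mean \<mu> f x \<theta> * post x \<theta> \<partial>\<nu>)"
    proof (rule integral_cong_AE)
      show "AE \<theta> in \<nu>. h x \<theta> * post x \<theta> = cond_mean \<mu> f x \<theta> * post x \<theta>"
        using elim(1) by eventually_elim simp
    qed measurable
    then show ?case
      using elim integral_cond_mean_post by (simp add: \<rho>_def)
  qed
  then have "AE w in lam \<Otimes>\<^sub>M \<mu> \<Otimes>\<^sub>M \<nu>. r (fst w) = \<rho> (fst w)"
    by (intro lam_mu_nu.AE_pair_measure) auto
  then have "AE w in Q. r (fst w) = \<rho> (fst w)"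
    unfolding Q_density by (subst AE_density) auto
  moreover have "AE w in Q. real_cond_exp Q (vimage_algebra (space Q) fst lam) (\<lambda>(x, y, \<theta>). y) w = \<rho> (fst w)"
    using real_cond_exp_density_pair[OF lam.sigma_finite_measure_axioms mu_nu.sigma_finite_measure_axioms
        joint_dens_meas less_imp_le[OF joint_dens_pos] Q_density prob_Q integrable_obs]
    by (simp add: \<rho>_def split_def)
  ultimately show "AE w in Q. real_cond_exp Q (vimage_algebra (space Q) fst lam) (\<lambda>(x, y, \<theta>). y) w = r (fst w)"
    by eventually_elim simp
qed simp

lemma square_integrable_law_X_theta:
  fixes g :: "'x \<times> real \<Rightarrow> real"
  assumes "square_integrable (law_X_theta lam \<mu> \<nu> f \<phi>) g"
  shows "g \<in> borel_measurable (lam \<Otimes>\<^sub>M \<nu>)"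
    and "AE x in lam. integrable \<nu> (\<lambda>\<theta>. g (x, \<theta>) * post x \<theta>)"
proof -
  let ?T = "\<lambda>(x, y, \<theta>). (x, \<theta>)"
  have T: "?T \<in> measurable Q (lam \<Otimes>\<^sub>M \<nu>)"
    by measurable
  show g [measurable]: "g \<in> borel_measurable (lam \<Otimes>\<^sub>M \<nu>)"
    using assms by (simp add: square_integrable_def law_X_theta_def)
  have "integrable Q (\<lambda>w. (g (?T w))\<^sup>2)"
    using assms unfolding square_integrable_def law_X_theta_def
    by (subst (asm) integrable_distr_eq[OF T]) auto
  moreover have "(\<lambda>w. g (?T w)) \<in> borel_measurable Q"
    using T g by (rule measurable_compose)
  ultimately have "integrable Q (\<lambda>w. g (?T w))"
    by (rule Q.square_integrable_imp_integrable[rotated])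
  from AE_integrable_slice[OF this] AE_regular
  show "AE x in lam. integrable \<nu> (\<lambda>\<theta>. g (x, \<theta>) * post x \<theta>)"
    by eventually_elim (auto intro: integrable_post simp: split_def)
qed

lemma posterior_mean_meas:
  assumes [measurable]: "g \<in> borel_measurable \<nu>"
  shows "posterior_mean \<mu> \<nu> f \<phi> g \<in> borel_measurable lam"
  unfolding posterior_mean_def[abs_def] by measurable

text \<open>Joint measurability of \<open>B \<theta> * C x\<close> gives the measurability of each factor only if the
  product is somewhere nonzero, by fixing one coordinate. Otherwise \<open>B\<close> or \<open>C\<close> is identically
  zero, and the function below is zero although the other factor may fail to be measurable.\<close>

lemma posterior_mean_mult_meas:
  assumes BC: "(\<lambda>(x, \<theta>). B \<theta> * C x) \<in> borel_measurable (lam \<Otimes>\<^sub>M \<nu>)"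
  shows "(\<lambda>x. posterior_mean \<mu> \<nu> f \<phi> B x * C x) \<in> borel_measurable lam"
proof (cases "\<exists>x\<in>space lam. \<exists>\<theta>\<in>space \<nu>. B \<theta> * C x \<noteq> 0")
  case True
  then obtain x \<theta> where x: "x \<in> space lam" "C x \<noteq> 0" and \<theta>: "\<theta> \<in> space \<nu>" "B \<theta> \<noteq> 0"
    by auto
  have "(\<lambda>t. B t * C x) \<in> borel_measurable \<nu>"
    using measurable_compose[OF measurable_Pair1'[OF x(1)] BC] by simp
  then have "(\<lambda>t. B t * C x / C x) \<in> borel_measurable \<nu>"
    by (rule borel_measurable_divide) simp
  then have "B \<in> borel_measurable \<nu>"
    using x by simp
  moreover have "(\<lambda>s. B \<theta> * C s) \<in> borel_measurable lam"
    using measurable_compose[OF measurable_Pair2'[OF \<theta>(1)] BC] by simp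
  then have "(\<lambda>s. B \<theta> * C s / B \<theta>) \<in> borel_measurable lam"
    by (rule borel_measurable_divide) simp
  then have "C \<in> borel_measurable lam"
    using \<theta> by simp
  ultimately show ?thesis
    by (intro borel_measurable_times posterior_mean_meas)
next
  case False
  have "posterior_mean \<mu> \<nu> f \<phi> B x * C x = 0" if "x \<in> space lam" for x
  proof (cases "C x = 0")
    case False
    with \<open>\<not> (\<exists>x\<in>space lam. _ x)\<close> that have "B \<theta> = 0" if "\<theta> \<in> space \<nu>" for \<theta>
      using that by auto
    then show ?thesis
      by (simp add: posterior_mean_def cong: Bochner_Integration.integral_cong)
  qed simp
  then show ?thesis
    by (subst measurable_cong[where g = "\<lambda>_. 0"]) auto
qed

text \<open>The posterior density integrates to \<open>1\<close> and \<open>C x\<close> is a constant under the posterior, so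
  linearity of the integral gives the three terms. The term \<open>B \<theta> * C x\<close> is kept together when
  checking integrability: \<open>B\<close> itself need not be integrable where \<open>C x = 0\<close>.\<close>

lemma is_the_bayes_predictor_separable_regression:
  assumes reg: "\<And>\<theta>. \<theta> \<in> space \<nu> \<Longrightarrow> AE (x, y) in P \<theta>. cond_mean \<mu> f x \<theta> = A x + B \<theta> * C x + D \<theta>"
    and A: "square_integrable (law_X_theta lam \<mu> \<nu> f \<phi>) (\<lambda>(x, \<theta>). A x)"
    and BC: "square_integrable (law_X_theta lam \<mu> \<nu> f \<phi>) (\<lambda>(x, \<theta>). B \<theta> * C x)"
    and D: "square_integrable (law_X_theta lam \<mu> \<nu> f \<phi>) (\<lambda>(x, \<theta>). D \<theta>)"
  shows "is_the_bayes_predictor lam Q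
           (\<lambda>x. A x + posterior_mean \<mu> \<nu> f \<phi> B x * C x + posterior_mean \<mu> \<nu> f \<phi> D x)"
proof (rule is_the_bayes_predictor_regression[OF _ reg])
  note meas = square_integrable_law_X_theta(1)[OF A] square_integrable_law_X_theta(1)[OF BC]
    square_integrable_law_X_theta(1)[OF D]
  show "(\<lambda>(x, \<theta>). A x + B \<theta> * C x + D \<theta>) \<in> borel_measurable (lam \<Otimes>\<^sub>M \<nu>)"
    using borel_measurable_add[OF borel_measurable_add[OF meas(1,2)] meas(3)] by (simp add: split_def)
  obtain x \<theta> where x: "x \<in> space lam" and \<theta>: "\<theta> \<in> space \<nu>"
    using space_lam_nonempty space_nu_nonempty by auto
  have "A \<in> borel_measurable lam"
    using measurable_compose[OF measurable_Pair2'[OF \<theta>] meas(1)] by simp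
  moreover have "D \<in> borel_measurable \<nu>"
    using measurable_compose[OF measurable_Pair1'[OF x] meas(3)] by simp
  ultimately show "(\<lambda>x. A x + posterior_mean \<mu> \<nu> f \<phi> B x * C x + posterior_mean \<mu> \<nu> f \<phi> D x)
      \<in> borel_measurable lam"
    by (intro borel_measurable_add posterior_mean_meas posterior_mean_mult_meas meas(2))
  show "AE x in lam. A x + posterior_mean \<mu> \<nu> f \<phi> B x * C x + posterior_mean \<mu> \<nu> f \<phi> D x
      = (\<integral>\<theta>. (A x + B \<theta> * C x + D \<theta>) * post x \<theta> \<partial>\<nu>)"
    using square_integrable_law_X_theta(2)[OF A] square_integrable_law_X_theta(2)[OF BC]
      square_integrable_law_X_theta(2)[OF D] AE_regular
  proof eventually_elim
    case (elim x)
    have "(\<integral>\<theta>. (A x + B \<theta> * C x + D \<theta>) * post x \<theta> \<partial>\<nu>)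
        = (\<integral>\<theta>. A x * post x \<theta> \<partial>\<nu>) + (\<integral>\<theta>. B \<theta> * C x * post x \<theta> \<partial>\<nu>) + (\<integral>\<theta>. D \<theta> * post x \<theta> \<partial>\<nu>)"
      using elim(1-3) by (simp add: distrib_right)
    also have "(\<integral>\<theta>. B \<theta> * C x * post x \<theta> \<partial>\<nu>) = (\<integral>\<theta>. (B \<theta> * post x \<theta>) * C x \<partial>\<nu>)"
      by (simp add: mult_ac)
    finally show ?case
      using integral_post[OF elim(4)] by (simp add: posterior_mean_def)
  qed
qed

subsection \<open>Independent observations\<close>

lemma f_section_meas:
  assumes [measurable]: "\<theta> \<in> space \<nu>"
  shows "(\<lambda>w. f (fst w) (snd w) \<theta>) \<in> borel_measurable (lam \<Otimes>\<^sub>M \<mu>)"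
  by measurable

lemma f_section_nonneg:
  assumes "\<theta> \<in> space \<nu>" "w \<in> space (lam \<Otimes>\<^sub>M \<mu>)"
  shows "0 \<le> f (fst w) (snd w) \<theta>"
  using assms f_pos by (auto simp: space_pair_measure less_imp_le)

text \<open>Both sides are versions of the conditional expectation of \<open>Y\<close> given \<open>X\<close>: the left one by the
  density formula, the right one by independence.\<close>

lemma cond_mean_indep:
  assumes \<theta> [measurable]: "\<theta> \<in> space \<nu>"
    and indep: "prob_space.indep_set (P \<theta>) (sets (vimage_algebra (space (P \<theta>)) fst lam))
                  (sets (vimage_algebra (space (P \<theta>)) snd \<mu>))"
    and Y2: "square_integrable (P \<theta>) (\<lambda>(x, y). y)"
  shows "AE (x, y) in P \<theta>. cond_mean \<mu> f x \<theta> = (\<integral>(x, y). y \<partial>P \<theta>)"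
proof -
  interpret P: prob_space "P \<theta>"
    using \<theta> by (rule prob_law)
  have [measurable_cong]: "sets (P \<theta>) = sets (lam \<Otimes>\<^sub>M \<mu>)"
    by (simp add: P_density)
  have Y1: "integrable (P \<theta>) snd"
    by (rule P.square_integrable_imp_integrable) (use Y2 in \<open>simp_all add: square_integrable_def split_def\<close>)
  have "snd \<in> space (P \<theta>) \<rightarrow> space \<mu>"
    by (auto simp: P_density space_pair_measure)
  from measurable_compose[OF measurable_vimage_algebra1[OF this] obs_meas]
  have "snd \<in> borel_measurable (vimage_algebra (space (P \<theta>)) snd \<mu>)" .
  moreover have "sigma_finite_subalgebra (P \<theta>) (vimage_algebra (space (P \<theta>)) fst lam)"
    by (rule P.sigma_finite_subalgebra_generated) simp
  ultimately have "AE w in P \<theta>. real_cond_exp (P \<theta>) (vimage_algebra (space (P \<theta>)) fst lam) snd w = (\<integral>w. snd w \<partial>P \<theta>)"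
    by (intro P.real_cond_exp_indep_set[OF _ _ indep Y1]) simp_all
  moreover have "AE w in P \<theta>. real_cond_exp (P \<theta>) (vimage_algebra (space (P \<theta>)) fst lam) snd w
      = cond_mean \<mu> f (fst w) \<theta>"
    using real_cond_exp_density_pair[OF lam.sigma_finite_measure_axioms mu.sigma_finite_measure_axioms
        f_section_meas[OF \<theta>] f_section_nonneg[OF \<theta>] P_density P.prob_space_axioms Y1]
    by (simp add: cond_mean_def)
  ultimately show ?thesis
    by eventually_elim (simp add: split_def)
qed

lemma is_the_bayes_predictor_indep:
  assumes Y2: "\<And>\<theta>. \<theta> \<in> space \<nu> \<Longrightarrow> square_integrable (P \<theta>) (\<lambda>(x, y). y)"
    and indep: "\<And>\<theta>. \<theta> \<in> space \<nu> \<Longrightarrow>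
      prob_space.indep_set (P \<theta>) (sets (vimage_algebra (space (P \<theta>)) fst lam))
        (sets (vimage_algebra (space (P \<theta>)) snd \<mu>))"
    and D: "\<And>\<theta>. \<theta> \<in> space \<nu> \<Longrightarrow> D \<theta> = (\<integral>(x, y). y \<partial>P \<theta>)"
  shows "is_the_bayes_predictor lam Q (posterior_mean \<mu> \<nu> f \<phi> D)"
proof (rule is_the_bayes_predictor_regression)
  have D_eq: "D \<theta> = (\<integral>w. f (fst w) (snd w) \<theta> * snd w \<partial>(lam \<Otimes>\<^sub>M \<mu>))" if \<theta>: "\<theta> \<in> space \<nu>" for \<theta>
  proof -
    have "D \<theta> = (\<integral>w. snd w \<partial>P \<theta>)"
      using D[OF \<theta>] by (simp add: split_def)
    also have "\<dots> = (\<integral>w. f (fst w) (snd w) \<theta> *\<^sub>R snd w \<partial>(lam \<Otimes>\<^sub>M \<mu>))"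
      unfolding P_density
      by (rule integral_density[OF _ f_section_meas[OF \<theta>]]) (auto intro: f_section_nonneg[OF \<theta>])
    finally show ?thesis
      by simp
  qed
  have "(\<lambda>\<theta>. \<integral>w. f (fst w) (snd w) \<theta> * snd w \<partial>(lam \<Otimes>\<^sub>M \<mu>)) \<in> borel_measurable \<nu>"
    by measurable
  then have D_meas [measurable]: "D \<in> borel_measurable \<nu>"
    using measurable_cong[of \<nu> D, OF D_eq] by blast
  show "(\<lambda>(x, \<theta>). D \<theta>) \<in> borel_measurable (lam \<Otimes>\<^sub>M \<nu>)"
    by measurable
  show "posterior_mean \<mu> \<nu> f \<phi> D \<in> borel_measurable lam"
    using D_meas by (rule posterior_mean_meas)
  show "AE (x, y) in P \<theta>. cond_mean \<mu> f x \<theta> = D \<theta>" if "\<theta> \<in> space \<nu>" for \<theta>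
    using cond_mean_indep[OF that indep Y2] that by (simp add: D)
qed (simp add: posterior_mean_def)

end

section \<open>The Bayesian predictor for separable regression functions\<close>

theorem proposition4p3:
  fixes F :: "(real ^ 'k) set" and G \<Theta> :: "real set"
    and lam :: "(real ^ 'k) measure" and \<mu> \<nu> :: "real measure"
    and f :: "real ^ 'k \<Rightarrow> real \<Rightarrow> real \<Rightarrow> real" and \<phi> :: "real \<Rightarrow> real"
  defines "P \<equiv> law_theta lam \<mu> f"
    and "Q \<equiv> law_joint lam \<mu> \<nu> f \<phi>"
    and "Q_XT \<equiv> law_X_theta lam \<mu> \<nu> f \<phi>"
  assumes F: "F = UNIV \<or> (CARD('k) = 1 \<and> F = {x. \<forall>i. x $ i \<in> \<nat>})"
    and G: "G = UNIV \<or> G = \<nat>"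
    and \<Theta>: "open \<Theta>"
    and lam: "sigma_finite_measure lam" "sets lam = sets (restrict_space borel F)"
    and \<mu>: "sigma_finite_measure \<mu>" "sets \<mu> = sets (restrict_space borel G)"
    and \<nu>: "sigma_finite_measure \<nu>" "sets \<nu> = sets (restrict_space borel \<Theta>)"
    and f_meas: "(\<lambda>(x, y, \<theta>). f x y \<theta>) \<in> borel_measurable (lam \<Otimes>\<^sub>M \<mu> \<Otimes>\<^sub>M \<nu>)"
    and f_nonneg: "\<And>x y \<theta>. x \<in> F \<Longrightarrow> y \<in> G \<Longrightarrow> \<theta> \<in> \<Theta> \<Longrightarrow> 0 \<le> f x y \<theta>"
    and P_prob: "\<And>\<theta>. \<theta> \<in> \<Theta> \<Longrightarrow> prob_space (P \<theta>)"
    and \<phi>_meas: "\<phi> \<in> borel_measurable \<nu>"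
    and \<phi>_nonneg: "\<And>\<theta>. \<theta> \<in> \<Theta> \<Longrightarrow> 0 \<le> \<phi> \<theta>"
    and \<phi>_prob: "prob_space (density \<nu> (\<lambda>\<theta>. ennreal (\<phi> \<theta>)))"
    and Y_L2_P: "\<And>\<theta>. \<theta> \<in> \<Theta> \<Longrightarrow> square_integrable (P \<theta>) (\<lambda>(x, y). y)"
    and Y_L2_Q: "square_integrable Q (\<lambda>(x, y, \<theta>). y)"
    and positive: "\<And>x y \<theta>. x \<in> F \<Longrightarrow> y \<in> G \<Longrightarrow> \<theta> \<in> \<Theta> \<Longrightarrow> 0 < f x y \<theta> * \<phi> \<theta>"
    and f_cont: "\<And>x y. x \<in> F \<Longrightarrow> y \<in> G \<Longrightarrow> continuous_on \<Theta> (f x y)"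
    and \<phi>_cont: "continuous_on \<Theta> \<phi>"
  shows "(\<forall>(A :: real ^ 'k \<Rightarrow> real) (B :: real \<Rightarrow> real) (C :: real ^ 'k \<Rightarrow> real) (D :: real \<Rightarrow> real).
            (\<forall>\<theta> \<in> \<Theta>. AE (x, y) in P \<theta>. cond_mean \<mu> f x \<theta> = A x + B \<theta> * C x + D \<theta>) \<longrightarrow>
            square_integrable Q_XT (\<lambda>(x, \<theta>). A x) \<longrightarrow>
            square_integrable Q_XT (\<lambda>(x, \<theta>). B \<theta> * C x) \<longrightarrow>
            square_integrable Q_XT (\<lambda>(x, \<theta>). D \<theta>) \<longrightarrow>
            is_the_bayes_predictor lam Q
              (\<lambda>x. A x + posterior_mean \<mu> \<nu> f \<phi> B x * C x + posterior_mean \<mu> \<nu> f \<phi> D x)) \<and>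
         (\<forall>D :: real \<Rightarrow> real.
            (\<forall>\<theta> \<in> \<Theta>. prob_space.indep_set (P \<theta>)
                (sets (vimage_algebra (space (P \<theta>)) fst lam))
                (sets (vimage_algebra (space (P \<theta>)) snd \<mu>))) \<longrightarrow>
            (\<forall>\<theta> \<in> \<Theta>. D \<theta> = (\<integral>(x, y). y \<partial>P \<theta>)) \<longrightarrow>
            is_the_bayes_predictor lam Q (posterior_mean \<mu> \<nu> f \<phi> D))"
proof -
  have spaces: "space lam = F" "space \<mu> = G" "space \<nu> = \<Theta>"
    using sets_eq_imp_space_eq[OF lam(2)] sets_eq_imp_space_eq[OF \<mu>(2)] sets_eq_imp_space_eq[OF \<nu>(2)]
    by (simp_all add: space_restrict_space)
  have "(\<lambda>y. y) \<in> borel_measurable \<mu>"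
    unfolding measurable_cong_sets[OF \<mu>(2) refl] by (intro measurable_restrict_space1) simp
  moreover have pos: "0 < f x y \<theta> \<and> 0 < \<phi> \<theta>" if "x \<in> F" "y \<in> G" "\<theta> \<in> \<Theta>" for x y \<theta>
    using positive[OF that] f_nonneg[OF that] \<phi>_nonneg[OF that(3)] by (auto simp: zero_less_mult_iff)
  moreover have "0 < \<phi> \<theta>" if "\<theta> \<in> \<Theta>" for \<theta>
  proof -
    \<comment> \<open>positivity is assumed of a product of functions of \<open>x\<close>, \<open>y\<close> and \<open>\<theta>\<close>,
      so some \<open>x\<close> and \<open>y\<close> must be exhibited\<close>
    have "0 \<in> F" "0 \<in> G"
      using F G by auto
    then show ?thesis
      using pos that by blast
  qed
  ultimately interpret bayes_model lam \<mu> \<nu> f \<phi>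
    using lam \<mu> \<nu> f_meas \<phi>_meas P_prob \<phi>_prob Y_L2_Q
    unfolding P_def Q_def
    by (auto simp: bayes_model_def bayes_model_axioms_def spaces)
  show ?thesis
    unfolding P_def Q_def Q_XT_def
    using is_the_bayes_predictor_separable_regression is_the_bayes_predictor_indep Y_L2_P
    by (simp add: spaces P_def)
qed

end
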